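(* Let $\mathcal U,\mathcal X,\mathcal Y$ be Hilbert spaces. Suppose that $S(z)=\sum_v s_vz^v\in\mathcal S_{nc,d}(\mathcal U,\mathcal Y)$ and that $(C,\mathbf A)$ is an observable, contractive output pair ($C\in\mathcal L(\mathcal X,\mathcal Y)$, $\mathbf A=(A_1,\dots,A_d)$, $A_j\in\mathcal L(\mathcal X)$) such that $K_S(z,w)=K_{C,\mathbf A}(z,w)$. Then there exists a unique operator $B=\begin{bmatrix} B_1 \\ \vdots \\ B_d \end{bmatrix}:\mathcal U\to\mathcal X^d$ such that $\mathbf U=\begin{bmatrix} A & B \\ C & s_\emptyset \end{bmatrix}:\mathcal X\oplus\mathcal U\to\mathcal X^d\oplus\mathcal Y$ is a coisometry and $\mathbf U$ provides a realization for $S$: $$S(z)=s_\emptyset+C(I-Z(z)A)^{-1}Z(z)B.$$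
   Context: $\mathcal L(\mathcal U,\mathcal Y)$ denotes the bounded linear operators between Hilbert spaces. $d\ge1$ is a fixed integer and $\mathcal F_d$ is the free semigroup with unit generated by the letters $\{1,\dots,d\}$: words $\alpha=i_N\cdots i_1$, product given by concatenation, unit the empty word $\emptyset$; $\alpha^\top=i_1\cdots i_N$. $z^\alpha=z_{i_N}\cdots z_{i_1}$, $z^\emptyset=1$; $\mathbf A^\alpha=A_{i_N}\cdots A_{i_1}$, $\mathbf A^\emptyset=I$. $z=(z_1,\dots,z_d)$ and $w=(w_1,\dots,w_d)$ are two sets of indeterminates, noncommuting within each set; each $z_i$ commutes with each $w_j$, and indeterminates commute with operator coefficients. Products of formal power series are given by convolution. If $S(z)=\sum_\alpha s_\alpha z^\alpha$ then $S(w)^*=\sum_\alpha s_\alpha^*w^{\alpha^\top}$. $H^2_{\mathcal Y}(\mathcal F_d)=\{f=\sum_\alpha f_\alpha z^\alpha:\ f_\alpha\in\mathcal Y,\ \|f\|^2=\sum_\alpha\|f_\alpha\|^2<\infty\}$. The noncommutative Schur class $\mathcal S_{nc,d}(\mathcal U,\mathcal Y)$ is the set of formal power series $S(z)=\sum_\alpha s_\alpha z^\alpha$, $s_\alpha\in\mathcal L(\mathcal U,\mathcal Y)$, for which $M_S:f(z)\mapsto S(z)f(z)$ is a contraction from $H^2_{\mathcal U}(\mathcal F_d)$ into $H^2_{\mathcal Y}(\mathcal F_d)$. For such $S$, $K_S(z,w)=k_{\rm Sz}(z,w)I_{\mathcal Y}-S(z)k_{\rm Sz}(z,w)S(w)^*$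 where $k_{\rm Sz}(z,w)=\sum_{\alpha}z^\alpha w^{\alpha^\top}$. An output pair $(C,\mathbf A)$ is contractive if $A_1^*A_1+\cdots+A_d^*A_d+C^*C\le I_{\mathcal X}$, and observable if the observability operator $x\mapsto\sum_v(C\mathbf A^vx)z^v$ is injective on $\mathcal X$. $A$ is the column of $A_1,\dots,A_d$ (an operator $\mathcal X\to\mathcal X^d$), $Z(z)=\begin{bmatrix}z_1I_{\mathcal X}&\cdots&z_dI_{\mathcal X}\end{bmatrix}$, $Z(w)^*$ is the column with entries $w_1I_{\mathcal X},\dots,w_dI_{\mathcal X}$, $(I-Z(z)A)^{-1}=\sum_v\mathbf A^vz^v$, so that $C(I-Z(z)A)^{-1}Z(z)B=\sum_{j=1}^d\sum_vC\mathbf A^vB_jz^vz_j$, and $$K_{C,\mathbf A}(z,w)=C(I-Z(z)A)^{-1}(I-A^*Z(w)^* )^{-1}C^*=\sum_{v,v'\in\mathcal F_d}C\mathbf A^v(\mathbf A^{v'})^*C^*z^vw^{v'^\top}.$$ A coisometry is an operator $\mathbf U$ with $\mathbf U\mathbf U^*=I$. *)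

theory Defs
  imports "HOL-Analysis.Analysis"
begin

section \<open>Complex Hilbert spaces\<close>

text \<open>The real Hilbert space structure of the library is kept, and the complex structure is
  added on top of it. The inner product is linear in its first argument. Positive definiteness
  is inherited from the real inner product through \<open>inner_eq_Re_cinner\<close>.\<close>

class complex_inner = real_inner +
  fixes scaleC :: "complex \<Rightarrow> 'a \<Rightarrow> 'a"  (infixr "*\<^sub>C" 75)
    and cinner :: "'a \<Rightarrow> 'a \<Rightarrow> complex"
  assumes scaleC_add_right: "c *\<^sub>C (x + y) = c *\<^sub>C x + c *\<^sub>C y"
    and scaleC_add_left: "(b + c) *\<^sub>C x = b *\<^sub>C x + c *\<^sub>C x"
    and scaleC_scaleC: "b *\<^sub>C c *\<^sub>C x = (b * c) *\<^sub>C x"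
    and scaleC_of_real: "complex_of_real r *\<^sub>C x = r *\<^sub>R x"
    and cinner_commute: "cinner x y = cnj (cinner y x)"
    and cinner_add_left: "cinner (x + y) z = cinner x z + cinner y z"
    and cinner_scaleC_left: "cinner (c *\<^sub>C x) y = c * cinner x y"
    and inner_eq_Re_cinner: "inner x y = Re (cinner x y)"

class chilbert_space = complex_inner + complete_space

instantiation complex :: chilbert_space
begin

definition scaleC_complex :: "complex \<Rightarrow> complex \<Rightarrow> complex"
  where "scaleC_complex c x = c * x"

definition cinner_complex :: "complex \<Rightarrow> complex \<Rightarrow> complex"
  where "cinner_complex x y = x * cnj y"

instance
  by standard
    (auto simp: scaleC_complex_def cinner_complex_def algebra_simps scaleR_conv_of_real
      inner_complex_def)

end

instantiation prod :: (complex_inner, complex_inner) complex_inner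
begin

definition scaleC_prod :: "complex \<Rightarrow> 'a \<times> 'b \<Rightarrow> 'a \<times> 'b"
  where "scaleC_prod c p = (c *\<^sub>C fst p, c *\<^sub>C snd p)"

definition cinner_prod :: "'a \<times> 'b \<Rightarrow> 'a \<times> 'b \<Rightarrow> complex"
  where "cinner_prod p q = cinner (fst p) (fst q) + cinner (snd p) (snd q)"

instance
proof
  fix p q :: "'a \<times> 'b"
  show "cinner p q = cnj (cinner q p)"
    by (simp add: cinner_prod_def cinner_commute[of "fst p"] cinner_commute[of "snd p"])
qed (auto simp: scaleC_prod_def cinner_prod_def scaleC_add_right scaleC_add_left scaleC_scaleC
    scaleC_of_real cinner_add_left cinner_scaleC_left inner_eq_Re_cinner inner_prod_def
    algebra_simps prod_eq_iff)

end

instance prod :: (chilbert_space, chilbert_space) chilbert_space ..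

instantiation vec :: (complex_inner, finite) complex_inner
begin

definition scaleC_vec :: "complex \<Rightarrow> 'a ^ 'b \<Rightarrow> 'a ^ 'b"
  where "scaleC_vec c x = (\<chi> j. c *\<^sub>C (x $ j))"

definition cinner_vec :: "'a ^ 'b \<Rightarrow> 'a ^ 'b \<Rightarrow> complex"
  where "cinner_vec x y = (\<Sum>j\<in>UNIV. cinner (x $ j) (y $ j))"

instance
proof
  fix x y :: "'a ^ 'b"
  show "cinner x y = cnj (cinner y x)"
    unfolding cinner_vec_def cnj_sum by (intro sum.cong refl cinner_commute)
qed (auto simp: scaleC_vec_def cinner_vec_def scaleC_add_right scaleC_add_left scaleC_scaleC
    scaleC_of_real cinner_add_left cinner_scaleC_left inner_eq_Re_cinner inner_vec_def
    sum.distrib sum_distrib_left vec_eq_iff)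

end

instance vec :: (chilbert_space, finite) chilbert_space ..


section \<open>Bounded operators\<close>

definition bounded_clinear :: "('a::complex_inner \<Rightarrow> 'b::complex_inner) \<Rightarrow> bool"
  where "bounded_clinear T \<longleftrightarrow> bounded_linear T \<and> (\<forall>c x. T (c *\<^sub>C x) = c *\<^sub>C T x)"

text \<open>Meaningful for bounded operators between Hilbert spaces, where the adjoint exists.\<close>

definition cadjoint :: "('a::complex_inner \<Rightarrow> 'b::complex_inner) \<Rightarrow> 'b \<Rightarrow> 'a"
  where "cadjoint T = (THE T'. \<forall>x y. cinner (T x) y = cinner x (T' y))"

definition op_le :: "('a::complex_inner \<Rightarrow> 'a) \<Rightarrow> ('a \<Rightarrow> 'a) \<Rightarrow> bool"
  where "op_le P Q \<longleftrightarrow> (\<forall>x. cinner (Q x - P x) x \<in> \<real>\<^sub>\<ge>\<^sub>0)"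

definition coisometry :: "('a::complex_inner \<Rightarrow> 'b::complex_inner) \<Rightarrow> bool"
  where "coisometry T \<longleftrightarrow> bounded_clinear T \<and> T \<circ> cadjoint T = id"


section \<open>Formal power series in noncommuting indeterminates\<close>

text \<open>The letters are the elements of a finite type \<open>'d\<close>, a word \<open>i\<^sub>N \<dots> i\<^sub>1\<close> is the list
  \<open>[i\<^sub>N, \<dots>, i\<^sub>1]\<close>, concatenation is \<open>@\<close> and transposition is \<open>rev\<close>. A formal power series is its
  coefficient function.\<close>

type_synonym ('d, 'a, 'b) op_series = "'d list \<Rightarrow> 'a \<Rightarrow> 'b"

text \<open>In a series in \<open>z\<close> and \<open>w\<close>, the coefficient at \<open>\<alpha> \<beta>\<close> is that of the monomial
  \<open>z\<^sup>\<alpha> w\<^sup>\<beta>\<close>, with no transposition of \<open>\<beta>\<close>.\<close>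

type_synonym ('d, 'a, 'b) op_biseries = "'d list \<Rightarrow> 'd list \<Rightarrow> 'a \<Rightarrow> 'b"

definition splits :: "'d list \<Rightarrow> ('d list \<times> 'd list) set"
  where "splits \<gamma> = {(\<alpha>, \<beta>). \<alpha> @ \<beta> = \<gamma>}"

definition series_apply ::
    "('d, 'a, 'b::comm_monoid_add) op_series \<Rightarrow> ('d list \<Rightarrow> 'a) \<Rightarrow> 'd list \<Rightarrow> 'b"
  where "series_apply F f \<gamma> = (\<Sum>(\<alpha>, \<beta>)\<in>splits \<gamma>. F \<alpha> (f \<beta>))"

definition series_mult ::
    "('d, 'b, 'c::comm_monoid_add) op_series \<Rightarrow> ('d, 'a, 'b) op_series \<Rightarrow> ('d, 'a, 'c) op_series"
    (infixl "\<star>" 70)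
  where "(F \<star> G) \<gamma> x = (\<Sum>(\<alpha>, \<beta>)\<in>splits \<gamma>. F \<alpha> (G \<beta> x))"

definition biseries_mult ::
    "('d, 'b, 'c::comm_monoid_add) op_biseries \<Rightarrow> ('d, 'a, 'b) op_biseries
      \<Rightarrow> ('d, 'a, 'c) op_biseries"  (infixl "\<star>\<star>" 70)
  where "(F \<star>\<star> G) \<gamma> \<delta> x =
    (\<Sum>(\<alpha>, \<alpha>')\<in>splits \<gamma>. \<Sum>(\<beta>, \<beta>')\<in>splits \<delta>. F \<alpha> \<beta> (G \<alpha>' \<beta>' x))"

definition series_const :: "('a \<Rightarrow> 'b::zero) \<Rightarrow> ('d, 'a, 'b) op_series"
  where "series_const T \<alpha> = (if \<alpha> = [] then T else (\<lambda>_. 0))"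

definition in_z :: "('d, 'a, 'b::zero) op_series \<Rightarrow> ('d, 'a, 'b) op_biseries"
  where "in_z F \<alpha> \<beta> = (if \<beta> = [] then F \<alpha> else (\<lambda>_. 0))"

definition in_w :: "('d, 'a, 'b::zero) op_series \<Rightarrow> ('d, 'a, 'b) op_biseries"
  where "in_w F \<alpha> \<beta> = (if \<alpha> = [] then F \<beta> else (\<lambda>_. 0))"

text \<open>The series \<open>\<Sum>\<^sub>\<alpha> s\<^sub>\<alpha>\<^sup>* w\<^bsup>rev \<alpha>\<^esup>\<close>, reindexed by the exponent of \<open>w\<close>.\<close>

definition series_adj ::
    "('d, 'a::complex_inner, 'b::complex_inner) op_series \<Rightarrow> ('d, 'b, 'a) op_series"
  where "series_adj F \<beta> = cadjoint (F (rev \<beta>))"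


section \<open>Schur class and its kernel\<close>

definition H2 :: "('d list \<Rightarrow> 'a::real_normed_vector) set"
  where "H2 = {f. (\<lambda>\<alpha>. (norm (f \<alpha>))\<^sup>2) summable_on UNIV}"

definition H2_norm :: "('d list \<Rightarrow> 'a::real_normed_vector) \<Rightarrow> real"
  where "H2_norm f = sqrt (\<Sum>\<^sub>\<infinity>\<alpha>. (norm (f \<alpha>))\<^sup>2)"

definition nc_schur_class :: "('d, 'u::complex_inner, 'y::complex_inner) op_series set"
  where "nc_schur_class =
    {S. (\<forall>\<alpha>. bounded_clinear (S \<alpha>)) \<and>
        (\<forall>f\<in>H2. series_apply S f \<in> H2 \<and> H2_norm (series_apply S f) \<le> H2_norm f)}"

text \<open>The Szego kernel times the identity operator.\<close>

definition szego_kernel :: "('d, 'a, 'a::zero) op_biseries"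
  where "szego_kernel \<alpha> \<beta> = (if \<beta> = rev \<alpha> then id else (\<lambda>_. 0))"

definition schur_kernel ::
    "('d, 'u::complex_inner, 'y::complex_inner) op_series \<Rightarrow> ('d, 'y, 'y) op_biseries"
  where "schur_kernel S \<alpha> \<beta> y =
    szego_kernel \<alpha> \<beta> y - (in_z S \<star>\<star> szego_kernel \<star>\<star> in_w (series_adj S)) \<alpha> \<beta> y"


section \<open>Output pairs\<close>

primrec op_word :: "('d \<Rightarrow> 'x \<Rightarrow> 'x) \<Rightarrow> 'd list \<Rightarrow> 'x \<Rightarrow> 'x"
  where
    "op_word A [] = id"
  | "op_word A (i # \<alpha>) = A i \<circ> op_word A \<alpha>"

definition output_pair ::
    "('x::complex_inner \<Rightarrow> 'y::complex_inner) \<Rightarrow> ('d::finite \<Rightarrow> 'x \<Rightarrow> 'x) \<Rightarrow> bool"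
  where "output_pair C A \<longleftrightarrow> bounded_clinear C \<and> (\<forall>j. bounded_clinear (A j))"

definition contractive_pair ::
    "('x::complex_inner \<Rightarrow> 'y::complex_inner) \<Rightarrow> ('d::finite \<Rightarrow> 'x \<Rightarrow> 'x) \<Rightarrow> bool"
  where "contractive_pair C A \<longleftrightarrow>
    op_le (\<lambda>x. (\<Sum>j\<in>UNIV. cadjoint (A j) (A j x)) + cadjoint C (C x)) id"

definition observability_op ::
    "('x \<Rightarrow> 'y) \<Rightarrow> ('d \<Rightarrow> 'x \<Rightarrow> 'x) \<Rightarrow> 'x \<Rightarrow> 'd list \<Rightarrow> 'y"
  where "observability_op C A x = (\<lambda>v. C (op_word A v x))"

definition observable_pair :: "('x \<Rightarrow> 'y) \<Rightarrow> ('d \<Rightarrow> 'x \<Rightarrow> 'x) \<Rightarrow> bool"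
  where "observable_pair C A \<longleftrightarrow> inj (observability_op C A)"

text \<open>The series \<open>\<Sum> C A\<^sup>v (A\<^bsup>v'\<^esup>)\<^sup>* C\<^sup>* z\<^sup>v w\<^bsup>rev v'\<^esup>\<close>, reindexed by the exponent of \<open>w\<close>.\<close>

definition pair_kernel ::
    "('x::complex_inner \<Rightarrow> 'y::complex_inner) \<Rightarrow> ('d \<Rightarrow> 'x \<Rightarrow> 'x) \<Rightarrow> ('d, 'y, 'y) op_biseries"
  where "pair_kernel C A \<alpha> \<beta> =
    C \<circ> op_word A \<alpha> \<circ> cadjoint (op_word A (rev \<beta>)) \<circ> cadjoint C"


section \<open>Colligations and realizations\<close>

definition colligation ::
    "('d::finite \<Rightarrow> 'x \<Rightarrow> 'x) \<Rightarrow> ('u \<Rightarrow> 'x ^ 'd) \<Rightarrow> ('x \<Rightarrow> 'y) \<Rightarrow> ('u \<Rightarrow> 'y)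
      \<Rightarrow> 'x::complex_inner \<times> 'u::complex_inner \<Rightarrow> ('x ^ 'd) \<times> 'y::complex_inner"
  where "colligation A B C D = (\<lambda>(x, u). ((\<chi> j. A j x) + B u, C x + D u))"

text \<open>The series \<open>(I - Z(z)A)\<^sup>-\<^sup>1 = \<Sum>\<^sub>v A\<^sup>v z\<^sup>v\<close>.\<close>

definition resolvent_series :: "('d \<Rightarrow> 'x \<Rightarrow> 'x) \<Rightarrow> ('d, 'x, 'x) op_series"
  where "resolvent_series A = op_word A"

text \<open>The row \<open>Z(z) = [z\<^sub>1 I \<dots> z\<^sub>d I]\<close>: its coefficient at the letter \<open>j\<close> is the \<open>j\<close>-th
  coordinate projection.\<close>

definition Z_series :: "('d::finite, 'x::zero ^ 'd, 'x) op_series"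
  where "Z_series \<alpha> x = (case \<alpha> of [j] \<Rightarrow> x $ j | _ \<Rightarrow> 0)"

definition transfer_series ::
    "('d::finite \<Rightarrow> 'x \<Rightarrow> 'x) \<Rightarrow> ('u \<Rightarrow> 'x ^ 'd) \<Rightarrow> ('x::complex_inner \<Rightarrow> 'y::complex_inner)
      \<Rightarrow> ('u \<Rightarrow> 'y) \<Rightarrow> ('d, 'u, 'y) op_series"
  where "transfer_series A B C D \<alpha> u =
    series_const D \<alpha> u
      + (series_const C \<star> resolvent_series A \<star> Z_series \<star> series_const B) \<alpha> u"

end

theory Submission
  imports Defs
begin

text \<open>Write \<open>O\<^sub>v = C A\<^sup>v\<close>. The kernel identity says that \<open>O\<^sub>v O\<^sub>w\<^sup>*\<close> is the coefficient
  \<open>schur_kernel S v (rev w)\<close>. By definition of \<open>K\<^sub>S\<close>, that coefficient is \<open>I\<close>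
  (when \<open>v = w\<close>, and \<open>0\<close> otherwise) minus the sum of \<open>s\<^sub>a s\<^sub>b\<^sup>*\<close> over all pairs \<open>a\<close>, \<open>b\<close>
  that remain when a common suffix is removed from \<open>v\<close> and \<open>w\<close>. If \<open>v\<close> and \<open>w\<close> end in the same
  letter, splitting off the term in which the removed suffix is empty leaves the coefficient for
  the words with that letter deleted; otherwise the empty suffix is the only common one. This turns
  the kernel identity into the equations

  \<^item> \<open>O\<^bsub>vi\<^esub> O\<^bsub>wj\<^esub>\<^sup>* + s\<^bsub>vi\<^esub> s\<^bsub>wj\<^esub>\<^sup>* = \<delta>\<^bsub>ij\<^esub> O\<^sub>v O\<^sub>w\<^sup>*\<close>,
  \<^item> \<open>O\<^sub>\<emptyset> O\<^bsub>wj\<^esub>\<^sup>* + s\<^sub>\<emptyset> s\<^bsub>wj\<^esub>\<^sup>* = 0\<close>,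
  \<^item> \<open>O\<^sub>\<emptyset> O\<^sub>\<emptyset>\<^sup>* + s\<^sub>\<emptyset> s\<^sub>\<emptyset>\<^sup>* = I\<close>.

  They state that the vectors \<open>e\<^sub>j \<otimes> O\<^sub>w\<^sup>* y\<close> and \<open>y\<close> of \<open>X\<^sup>d \<oplus> Y\<close> have the same Gram matrix as
  the vectors \<open>(O\<^bsub>wj\<^esub>\<^sup>* y, s\<^bsub>wj\<^esub>\<^sup>* y)\<close> and \<open>(C\<^sup>* y, s\<^sub>\<emptyset>\<^sup>* y)\<close> of \<open>X \<oplus> U\<close> (\<open>gram_equality\<close>).
  Observability makes the first family total (\<open>shifted_kernel_vectors_total\<close>), so there is an
  isometry \<open>V\<close> from \<open>X\<^sup>d \<oplus> Y\<close> to \<open>X \<oplus> U\<close> that carries the first family to the second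
  (\<open>isometry_from_gram_equality\<close>). Its adjoint is the required coisometry: pairing \<open>V\<^sup>*\<close> with the
  total family, and using \<open>O\<^bsub>wj\<^esub> = O\<^sub>w A\<^sub>j\<close>, shows that its first column is \<open>(A, C)\<close>, that its lower
  right entry is \<open>s\<^sub>\<emptyset>\<close>, and that its remaining entry \<open>B\<close> satisfies \<open>O\<^sub>w B\<^sub>j = s\<^bsub>wj\<^esub>\<close>. These last
  equations are the realization formula, coefficient by coefficient, and by observability they
  determine \<open>B\<close>.\<close>

section \<open>Orthogonal complements and the Riesz representation\<close>

lemma parallelogram_law:
  fixes p q :: "'a::real_inner"
  shows "(norm (p - q))\<^sup>2 + (norm (p + q))\<^sup>2 = 2 * (norm p)\<^sup>2 + 2 * (norm q)\<^sup>2"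
  by (simp add: power2_norm_eq_inner inner_diff inner_add)

text \<open>The parallelogram law makes every minimizing sequence a Cauchy sequence.\<close>

lemma nearest_point_closed_subspace:
  fixes M :: "'a::{real_inner,complete_space} set"
  assumes M: "subspace M" and "closed M"
  obtains m where "m \<in> M" and "\<And>v. v \<in> M \<Longrightarrow> norm (x - m) \<le> norm (x - v)"
proof -
  define d where "d = (INF m\<in>M. (norm (x - m))\<^sup>2)"
  have ne: "M \<noteq> {}"
    using M subspace_0 by blast
  have bdd: "bdd_below ((\<lambda>m. (norm (x - m))\<^sup>2) ` M)"
    by (rule bdd_belowI[of _ 0]) auto
  have d_le: "d \<le> (norm (x - v))\<^sup>2" if "v \<in> M" for v
    unfolding d_def using bdd that by (rule cINF_lower)
  have "\<exists>m\<in>M. (norm (x - m))\<^sup>2 < d + inverse (real (Suc n))" for n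
    using cINF_less_iff[OF ne bdd, of "d + inverse (real (Suc n))"] d_def by simp
  then obtain m where mM: "\<And>n. m n \<in> M"
    and m_less: "\<And>n. (norm (x - m n))\<^sup>2 < d + inverse (real (Suc n))"
    by metis
  have gap: "(dist (m n) (m k))\<^sup>2 \<le> 2 * inverse (real (Suc n)) + 2 * inverse (real (Suc k))" for n k
  proof -
    have "(1/2) *\<^sub>R (m n + m k) \<in> M"
      using M mM by (intro subspace_scale subspace_add)
    then have "d \<le> (norm (x - (1/2) *\<^sub>R (m n + m k)))\<^sup>2"
      by (rule d_le)
    moreover have "(dist (m n) (m k))\<^sup>2 + 4 * (norm (x - (1/2) *\<^sub>R (m n + m k)))\<^sup>2
        = 2 * (norm (x - m n))\<^sup>2 + 2 * (norm (x - m k))\<^sup>2"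
    proof -
      let ?p = "x - m n" and ?q = "x - m k"
      have "x - (1/2) *\<^sub>R (m n + m k) = (1/2) *\<^sub>R (?p + ?q)"
      proof -
        have eq: "?p + ?q = 2 *\<^sub>R x - (m n + m k)" by (simp add: scaleR_2)
        show ?thesis unfolding eq by (simp add: scaleR_diff_right)
      qed
      then have "4 * (norm (x - (1/2) *\<^sub>R (m n + m k)))\<^sup>2 = (norm (?p + ?q))\<^sup>2"
        by (simp add: power_mult_distrib power_divide)
      moreover have "dist (m n) (m k) = norm (?p - ?q)"
        by (simp add: dist_norm norm_minus_commute)
      moreover have "(norm (?p - ?q))\<^sup>2 + (norm (?p + ?q))\<^sup>2 = 2 * (norm ?p)\<^sup>2 + 2 * (norm ?q)\<^sup>2"
        by (rule parallelogram_law)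
      ultimately show ?thesis by simp
    qed
    ultimately show ?thesis
      using m_less[of n] m_less[of k] by linarith
  qed
  have "Cauchy m"
  proof (rule metric_CauchyI)
    fix e :: real assume "0 < e"
    then have "0 < e\<^sup>2 / 4" by simp
    then obtain N where N: "inverse (real (Suc N)) < e\<^sup>2 / 4"
      using reals_Archimedean by blast
    have "dist (m n) (m k) < e" if "n \<ge> N" "k \<ge> N" for n k
    proof -
      have "inverse (real (Suc n)) \<le> inverse (real (Suc N))"
        "inverse (real (Suc k)) \<le> inverse (real (Suc N))"
        using that by (auto intro!: le_imp_inverse_le)
      then have "(dist (m n) (m k))\<^sup>2 < e\<^sup>2"
        using gap[of n k] N by linarith
      then show ?thesis
        using \<open>0 < e\<close> by (simp add: power2_less_imp_less)
    qed
    then show "\<exists>N. \<forall>n\<ge>N. \<forall>k\<ge>N. dist (m n) (m k) < e" by blast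
  qed
  then obtain l where l: "m \<longlonglongrightarrow> l"
    using Cauchy_convergent convergent_def by blast
  have lM: "l \<in> M"
    using \<open>closed M\<close> mM l closed_sequentially by blast
  have "(\<lambda>n. (norm (x - m n))\<^sup>2) \<longlonglongrightarrow> (norm (x - l))\<^sup>2"
    by (intro tendsto_intros l)
  moreover have "(\<lambda>n. d + inverse (real (Suc n))) \<longlonglongrightarrow> d + 0"
    by (intro tendsto_intros LIMSEQ_inverse_real_of_nat)
  ultimately have "(norm (x - l))\<^sup>2 \<le> d + 0"
    using m_less by (intro LIMSEQ_le) (auto intro: less_imp_le)
  then have "norm (x - l) \<le> norm (x - v)" if "v \<in> M" for v
    using d_le[OF that] by (auto intro: power2_le_imp_le[OF order_trans])
  with lM show thesis
    by (rule that)
qed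

text \<open>The vector from the nearest point of the subspace to \<open>x\<close> is normal: otherwise a small step along
  the subspace would come closer to \<open>x\<close>.\<close>

lemma closed_proper_subspace_has_normal:
  fixes M :: "'a::{real_inner,complete_space} set"
  assumes M: "subspace M" and "closed M" and "x \<notin> M"
  obtains w where "w \<noteq> 0" and "\<And>v. v \<in> M \<Longrightarrow> inner w v = 0"
proof -
  obtain m where m: "m \<in> M" and near: "\<And>v. v \<in> M \<Longrightarrow> norm (x - m) \<le> norm (x - v)"
    using nearest_point_closed_subspace[OF assms(1,2)] by metis
  define w where "w = x - m"
  have "inner w v = 0" if v: "v \<in> M" for v
  proof (cases "v = 0")
    case False
    \<comment> \<open>The step \<open>t\<close> minimizes the distance from \<open>x\<close> along the line through \<open>m\<close> in direction \<open>v\<close>.\<close>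
    define t where "t = inner w v / inner v v"
    have "m + t *\<^sub>R v \<in> M"
      using M m v by (intro subspace_add subspace_scale)
    then have "norm w \<le> norm (w - t *\<^sub>R v)"
      using near by (fastforce simp: w_def algebra_simps)
    then have "(norm w)\<^sup>2 \<le> (norm (w - t *\<^sub>R v))\<^sup>2"
      by (intro power_mono) auto
    also have "\<dots> = (norm w)\<^sup>2 - 2 * t * inner w v + t * (t * inner v v)"
      by (simp add: power2_norm_eq_inner inner_diff inner_commute algebra_simps)
    also have "t * inner v v = inner w v"
      using False by (simp add: t_def)
    finally have "t * inner w v \<le> 0"
      by (simp add: algebra_simps)
    then have "(inner w v)\<^sup>2 / inner v v \<le> 0"
      by (simp add: t_def power2_eq_square)
    then show ?thesis
      using False pos_divide_le_eq[of "inner v v" "(inner w v)\<^sup>2" 0] by simp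
  qed simp
  moreover have "w \<noteq> 0"
    using m \<open>x \<notin> M\<close> by (auto simp: w_def)
  ultimately show thesis
    using that by blast
qed

lemma subspace_closure:
  fixes M :: "'a::real_normed_vector set"
  assumes "subspace M"
  shows "subspace (closure M)"
proof (rule subspaceI)
  show "0 \<in> closure M"
    using subspace_0[OF assms] closure_subset by blast
next
  fix x y assume "x \<in> closure M" "y \<in> closure M"
  then obtain f g where "\<And>n. f n \<in> M" "\<And>n. g n \<in> M" "f \<longlonglongrightarrow> x" "g \<longlonglongrightarrow> y"
    unfolding closure_sequential by metis
  then show "x + y \<in> closure M"
    unfolding closure_sequential
    by (intro exI[of _ "\<lambda>n. f n + g n"]) (auto intro: tendsto_add subspace_add[OF assms])
next
  fix x :: 'a and c :: real assume "x \<in> closure M"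
  then obtain f where "\<And>n. f n \<in> M" "f \<longlonglongrightarrow> x"
    unfolding closure_sequential by metis
  then show "c *\<^sub>R x \<in> closure M"
    unfolding closure_sequential
    by (intro exI[of _ "\<lambda>n. c *\<^sub>R f n"])
      (auto intro: tendsto_scaleR subspace_scale[OF assms])
qed

text \<open>A normal vector of the kernel represents the functional up to a scalar.\<close>

lemma riesz_representation:
  fixes f :: "'a::{real_inner,complete_space} \<Rightarrow> real"
  assumes f: "bounded_linear f"
  obtains z where "\<And>x. f x = inner x z"
proof (cases "\<forall>x. f x = 0")
  case True
  then show thesis using that[of 0] by simp
next
  case False
  interpret bounded_linear f by fact
  obtain x0 where "f x0 \<noteq> 0" using False by blast
  have "subspace {x. f x = 0}" (is "subspace ?N")
    by (auto simp: subspace_def add scaleR zero)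
  moreover have "closed ?N"
    by (intro closed_Collect_eq continuous_on continuous_on_id continuous_on_const)
  moreover have "x0 \<notin> ?N"
    using \<open>f x0 \<noteq> 0\<close> by simp
  ultimately obtain w where w: "w \<noteq> 0" and "\<And>v. v \<in> ?N \<Longrightarrow> inner w v = 0"
    using closed_proper_subspace_has_normal by metis
  then have ortho: "inner w v = 0" if "f v = 0" for v
    using that by simp
  have fw: "f w \<noteq> 0" using w ortho[of w] by auto
  have "f x = inner x ((f w / inner w w) *\<^sub>R w)" for x
  proof -
    have "f (x - (f x / f w) *\<^sub>R w) = 0"
      using fw by (simp add: diff scaleR)
    then have "inner w x = f x / f w * inner w w"
      using ortho[of "x - (f x / f w) *\<^sub>R w"] by (simp add: inner_diff)
    then show ?thesis
      using fw w by (simp add: inner_commute field_simps)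
  qed
  then show thesis by (rule that)
qed


section \<open>Operators on complex Hilbert spaces and their adjoints\<close>

lemma inner_scaleC_imaginary: "inner (\<i> *\<^sub>C x) y = - Im (cinner x y)"
  by (simp add: inner_eq_Re_cinner cinner_scaleC_left)

lemma cinner_eq_if_inner_eq:
  assumes "inner x y = inner x' y'" and "inner (\<i> *\<^sub>C x) y = inner (\<i> *\<^sub>C x') y'"
  shows "cinner x y = cinner x' y'"
  using assms unfolding inner_scaleC_imaginary by (simp add: complex_eq_iff inner_eq_Re_cinner)

lemma cinner_scaleC_right: "cinner x (c *\<^sub>C y) = cnj c * cinner x y"
  unfolding cinner_commute[of x "c *\<^sub>C y"] cinner_commute[of x y]
  by (simp add: cinner_scaleC_left)

lemma cinner_self: "cinner x x = complex_of_real ((norm x)\<^sup>2)"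
proof -
  have "Im (cinner x x) = 0"
    using cinner_commute[of x x] by (metis Im_complex_of_real Reals_cnj_iff complex_is_Real_iff)
  then show ?thesis
    by (simp add: complex_eq_iff power2_norm_eq_inner inner_eq_Re_cinner)
qed

lemma norm_scaleC: "norm (c *\<^sub>C x) = cmod c * norm x" for x :: "'a::complex_inner"
proof -
  have "complex_of_real ((norm (c *\<^sub>C x))\<^sup>2) = complex_of_real ((cmod c * norm x)\<^sup>2)"
    unfolding cinner_self[of "c *\<^sub>C x", symmetric] cinner_scaleC_left cinner_scaleC_right power_mult_distrib
      of_real_mult complex_norm_square[of c] cinner_self[of x, symmetric] by simp
  then have "(norm (c *\<^sub>C x))\<^sup>2 = (cmod c * norm x)\<^sup>2"
    by (simp only: of_real_eq_iff)
  then show ?thesis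
    by (rule power2_eq_imp_eq) auto
qed

lemma scaleC_zero_right: "c *\<^sub>C 0 = (0 :: 'a::complex_inner)"
  using norm_scaleC[of c "0 :: 'a"] by simp

lemma bounded_bilinear_cinner: "bounded_bilinear (cinner :: 'a::complex_inner \<Rightarrow> 'a \<Rightarrow> complex)"
proof
  fix x x' y y' :: 'a and r :: real
  show "cinner (x + x') y = cinner x y + cinner x' y"
    by (rule cinner_add_left)
  show "cinner x (y + y') = cinner x y + cinner x y'"
    unfolding cinner_commute[of x "y + y'"] cinner_commute[of x y] cinner_commute[of x y']
    by (simp add: cinner_add_left)
  show "cinner (r *\<^sub>R x) y = r *\<^sub>R cinner x y"
    by (metis cinner_scaleC_left scaleC_of_real scaleR_conv_of_real)
  show "cinner x (r *\<^sub>R y) = r *\<^sub>R cinner x y"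
    by (metis cinner_scaleC_right scaleC_of_real scaleR_conv_of_real complex_cnj_complex_of_real)
  have "cmod (cinner a b) \<le> norm a * norm b * 2" for a b :: 'a
  proof -
    have "cmod (cinner a b) \<le> \<bar>inner a b\<bar> + \<bar>inner (\<i> *\<^sub>C a) b\<bar>"
      using cmod_le[of "cinner a b"] unfolding inner_scaleC_imaginary
      by (simp add: inner_eq_Re_cinner)
    also have "\<dots> \<le> norm a * norm b + norm (\<i> *\<^sub>C a) * norm b"
      by (intro add_mono Cauchy_Schwarz_ineq2)
    finally show ?thesis by (simp add: norm_scaleC)
  qed
  then show "\<exists>K. \<forall>a b :: 'a. cmod (cinner a b) \<le> norm a * norm b * K" by blast
qed

interpretation cinner: bounded_bilinear cinner
  by (rule bounded_bilinear_cinner)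

lemma cinner_right_ext:
  assumes "\<And>x. cinner x y = cinner x z" shows "y = z"
proof -
  have "cinner (y - z) (y - z) = 0" using assms by (simp add: cinner.diff_right)
  then show ?thesis by (simp add: cinner_self)
qed

lemma cinner_left_ext:
  assumes "\<And>y. cinner x y = cinner z y" shows "x = z"
  by (rule cinner_right_ext) (simp add: cinner_commute[of _ x] cinner_commute[of _ z] assms)

lemma bounded_clinearD:
  assumes "bounded_clinear T"
  shows "bounded_linear T" and "T (c *\<^sub>C x) = c *\<^sub>C T x"
    and "T (x + y) = T x + T y" and "T 0 = 0"
  using assms by (auto simp: bounded_clinear_def bounded_linear.linear linear_add linear_0)

lemma bounded_clinearI:
  assumes "\<And>x y. T (x + y) = T x + T y" and "\<And>c x. T (c *\<^sub>C x) = c *\<^sub>C T x"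
    and "\<And>x. norm (T x) \<le> norm x * K"
  shows "bounded_clinear T"
  unfolding bounded_clinear_def
proof
  show "bounded_linear T"
    by (rule bounded_linear_intro[where K = K]) (use assms in \<open>metis scaleC_of_real\<close>)+
qed (use assms in auto)

lemma cadjoint_unique:
  assumes "\<And>x y. cinner (T x) y = cinner x (T' y)"
  shows "cadjoint T = T'"
  unfolding cadjoint_def
proof (rule the_equality)
  fix R assume "\<forall>x y. cinner (T x) y = cinner x (R y)"
  then have "cinner x (R y) = cinner x (T' y)" for x y using assms by metis
  then have "R y = T' y" for y by (rule cinner_right_ext)
  then show "R = T'" by blast
qed (use assms in blast)

text \<open>The Riesz vector is found for the real inner product; complex linearity of \<open>T\<close> upgrades the
  identity, since the imaginary part of \<open>cinner x y\<close> is \<open>- inner (\<i> *\<^sub>C x) y\<close>.\<close>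

lemma cinner_cadjoint:
  fixes T :: "'a::chilbert_space \<Rightarrow> 'b::complex_inner"
  assumes T: "bounded_clinear T"
  shows "cinner (T x) y = cinner x (cadjoint T y)"
proof -
  have "\<exists>z. \<forall>x. cinner (T x) y = cinner x z" for y
  proof -
    have "bounded_linear (\<lambda>x. inner (T x) y)"
      using bounded_linear_compose[OF bounded_linear_inner_left bounded_clinearD(1)[OF T]] .
    then obtain z where z: "\<And>x. inner (T x) y = inner x z"
      using riesz_representation by blast
    then have "cinner (T x) y = cinner x z" for x
      by (intro cinner_eq_if_inner_eq) (simp_all add: bounded_clinearD(2)[OF T, symmetric])
    then show ?thesis by blast
  qed
  then obtain T' where "\<And>x y. cinner (T x) y = cinner x (T' y)" by metis
  then show ?thesis using cadjoint_unique by metis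
qed

lemma cinner_cadjoint':
  fixes T :: "'a::chilbert_space \<Rightarrow> 'b::complex_inner"
  assumes "bounded_clinear T"
  shows "cinner y (T x) = cinner (cadjoint T y) x"
  unfolding cinner_commute[of y] cinner_commute[of "cadjoint T y"] cinner_cadjoint[OF assms] ..

lemma bounded_clinear_cadjoint:
  fixes T :: "'a::chilbert_space \<Rightarrow> 'b::complex_inner"
  assumes T: "bounded_clinear T"
  shows "bounded_clinear (cadjoint T)"
proof -
  interpret bounded_linear T by (rule bounded_clinearD(1)[OF T])
  obtain K where K: "\<And>x. norm (T x) \<le> norm x * K" and "0 < K" using pos_bounded by blast
  have "norm (cadjoint T y) \<le> norm y * K" for y
  proof (cases "cadjoint T y = 0")
    case False
    have "(norm (cadjoint T y))\<^sup>2 = inner (T (cadjoint T y)) y"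
      by (simp add: inner_eq_Re_cinner cinner_cadjoint[OF T] cinner_self)
    also have "\<dots> \<le> norm (T (cadjoint T y)) * norm y" by (rule norm_cauchy_schwarz)
    also have "\<dots> \<le> norm (cadjoint T y) * K * norm y" by (intro mult_right_mono K) auto
    finally show ?thesis using False by (simp add: power2_eq_square algebra_simps)
  qed (use \<open>0 < K\<close> in auto)
  moreover have "cadjoint T (y + y') = cadjoint T y + cadjoint T y'" for y y'
    by (rule cinner_right_ext) (simp add: cinner.add_right flip: cinner_cadjoint[OF T])
  moreover have "cadjoint T (c *\<^sub>C y) = c *\<^sub>C cadjoint T y" for c y
    by (rule cinner_right_ext) (simp add: cinner_scaleC_right flip: cinner_cadjoint[OF T])
  ultimately show ?thesis
    by (intro bounded_clinearI)
qed

lemma bounded_clinear_compose: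
  assumes "bounded_clinear F" "bounded_clinear G"
  shows "bounded_clinear (F \<circ> G)"
  using assms by (auto simp: bounded_clinear_def comp_def intro: bounded_linear_compose)

lemma cadjoint_compose:
  fixes F :: "'b::chilbert_space \<Rightarrow> 'c::complex_inner" and G :: "'a::chilbert_space \<Rightarrow> 'b"
  assumes "bounded_clinear F" "bounded_clinear G"
  shows "cadjoint (F \<circ> G) = cadjoint G \<circ> cadjoint F"
  by (rule cadjoint_unique) (simp add: cinner_cadjoint assms)

lemma bounded_clinear_op_word:
  assumes "\<And>j. bounded_clinear (A j)"
  shows "bounded_clinear (op_word A \<alpha>)"
proof (induction \<alpha>)
  case Nil
  show ?case by (rule bounded_clinearI[where K = 1]) auto
next
  case (Cons i \<alpha>)
  then show ?case by (auto simp del: comp_apply intro: bounded_clinear_compose assms)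
qed

lemma op_word_append: "op_word A (\<alpha> @ \<beta>) = op_word A \<alpha> \<circ> op_word A \<beta>"
  by (induction \<alpha>) (auto simp: comp_assoc)


section \<open>Isometries prescribed on a total family\<close>

text \<open>Preserving inner products forces linearity: the squared norm of \<open>V (x + y) - (V x + V y)\<close> expands
  into inner products that cancel, and likewise for scalar multiples.\<close>

lemma bounded_clinear_if_preserves_cinner:
  assumes V: "\<And>x y. cinner (V x) (V y) = cinner x y"
  shows "bounded_clinear V"
proof (rule bounded_clinearI[where K = 1])
  fix x y c
  have "cinner (V (x + y) - (V x + V y)) (V (x + y) - (V x + V y)) = 0"
    by (simp add: cinner.diff_left cinner.diff_right cinner.add_left cinner.add_right V)
  then show "V (x + y) = V x + V y" by (simp add: cinner_self)
  have "cinner (V (c *\<^sub>C x) - c *\<^sub>C V x) (V (c *\<^sub>C x) - c *\<^sub>C V x) = 0"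
    by (simp add: cinner.diff_left cinner.diff_right cinner_scaleC_left cinner_scaleC_right V)
  then show "V (c *\<^sub>C x) = c *\<^sub>C V x" by (simp add: cinner_self)
  have "cinner (V x) (V x) = cinner x x" by (rule V)
  then have "(norm (V x))\<^sup>2 = (norm x)\<^sup>2" unfolding cinner_self of_real_eq_iff .
  then show "norm (V x) \<le> norm x * 1" by simp
qed

text \<open>The graph of the isometry is built directly, as the closed subspace \<open>G\<close> generated by the complex
  multiples of the pairs \<open>(a i, b i)\<close>. The Gram hypothesis passes from generators to all of \<open>G\<close>, one
  argument at a time. Hence the two components of a point of \<open>G\<close> have equal norms, which makes \<open>G\<close>
  single-valued, and makes its first projection complete and therefore closed. Being total, that
  projection is the whole space.\<close>

lemma isometry_from_gram_equality:
  fixes a :: "'i \<Rightarrow> 'a::chilbert_space" and b :: "'i \<Rightarrow> 'b::chilbert_space"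
  assumes gram: "\<And>i j. cinner (b i) (b j) = cinner (a i) (a j)"
    and total: "\<And>x. (\<And>i. cinner x (a i) = 0) \<Longrightarrow> x = 0"
  obtains V where "\<And>x y. cinner (V x) (V y) = cinner x y" and "\<And>i. V (a i) = b i"
proof -
  define R where "R = {(c *\<^sub>C a i, c *\<^sub>C b i) | c i. True}"
  define G where "G = closure (span R)"
  have one: "1 *\<^sub>C x = x" for x :: "'z::complex_inner"
    using scaleC_of_real[of 1 x] by simp
  have subG: "subspace G"
    unfolding G_def by (intro subspace_closure subspace_span)
  have clG: "closed G" unfolding G_def by simp
  have RG: "R \<subseteq> G"
    unfolding G_def using span_superset closure_subset by blast
  have G_minimal: "G \<subseteq> M" if "R \<subseteq> M" "subspace M" "closed M" for M
    unfolding G_def using that by (intro closure_minimal span_minimal)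
  have cont: "continuous_on UNIV (\<lambda>q. cinner (f q) y)" "continuous_on UNIV (\<lambda>q. cinner y (f q))"
    if "continuous_on UNIV f" for f :: "'a \<times> 'b \<Rightarrow> 'z::complex_inner" and y
    using that by (intro cinner.continuous_on continuous_on_const; simp)+
  have pres_R: "cinner (snd p) (snd q) = cinner (fst p) (fst q)" if "p \<in> G" "q \<in> R" for p q
  proof -
    have "G \<subseteq> {p. cinner (snd p) (snd q) = cinner (fst p) (fst q)}"
    proof (rule G_minimal)
      show "R \<subseteq> {p. cinner (snd p) (snd q) = cinner (fst p) (fst q)}"
        using \<open>q \<in> R\<close> by (auto simp: R_def cinner_scaleC_left cinner_scaleC_right gram)
      show "subspace {p. cinner (snd p) (snd q) = cinner (fst p) (fst q)}"
        by (auto simp: subspace_def cinner.zero_left cinner.add_left cinner.scaleR_left)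
      show "closed {p. cinner (snd p) (snd q) = cinner (fst p) (fst q)}"
        by (intro closed_Collect_eq cont continuous_intros)
    qed
    with \<open>p \<in> G\<close> show ?thesis by blast
  qed
  have pres: "cinner (snd p) (snd q) = cinner (fst p) (fst q)" if "p \<in> G" "q \<in> G" for p q
  proof -
    have "G \<subseteq> {q. cinner (snd p) (snd q) = cinner (fst p) (fst q)}"
    proof (rule G_minimal)
      show "R \<subseteq> {q. cinner (snd p) (snd q) = cinner (fst p) (fst q)}"
        using pres_R[OF \<open>p \<in> G\<close>] by blast
      show "subspace {q. cinner (snd p) (snd q) = cinner (fst p) (fst q)}"
        by (auto simp: subspace_def cinner.zero_right cinner.add_right cinner.scaleR_right)
      show "closed {q. cinner (snd p) (snd q) = cinner (fst p) (fst q)}"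
        by (intro closed_Collect_eq cont continuous_intros)
    qed
    with \<open>q \<in> G\<close> show ?thesis by blast
  qed
  have norm_eq: "norm (snd p) = norm (fst p)" if "p \<in> G" for p
  proof -
    have "(norm (snd p))\<^sup>2 = (norm (fst p))\<^sup>2"
      using pres[OF that that] unfolding cinner_self of_real_eq_iff .
    then show ?thesis by (simp add: power2_eq_iff_nonneg)
  qed
  have sub1: "subspace (fst ` G)"
    using bounded_linear.linear[OF bounded_linear_fst] subG by (rule linear_subspace_image)
  have cl1: "closed (fst ` G)"
  proof -
    have "complete (fst ` G)"
    proof (rule complete_isometric_image[of "1/2"])
      show "\<forall>p\<in>G. norm (fst p) \<ge> 1/2 * norm p"
      proof
        fix p assume "p \<in> G"
        then show "norm (fst p) \<ge> 1/2 * norm p"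
          using norm_eq[of p] norm_Pair_le[of "fst p" "snd p"] by simp
      qed
      show "complete G" using clG by (simp add: complete_eq_closed)
    qed (use subG bounded_linear_fst in auto)
    then show ?thesis by (rule complete_imp_closed)
  qed
  have full: "x \<in> fst ` G" for x
  proof (rule ccontr)
    assume "x \<notin> fst ` G"
    then obtain w where "w \<noteq> 0" and w: "\<And>v. v \<in> fst ` G \<Longrightarrow> inner w v = 0"
      using closed_proper_subspace_has_normal[OF sub1 cl1] by metis
    have "cinner w (a i) = 0" for i
    proof -
      \<comment> \<open>With this scalar, the real inner product of \<open>w\<close> and \<open>c *\<^sub>C a i\<close> is \<open>(cmod c)\<^sup>2\<close>.\<close>
      define c where "c = cinner w (a i)"
      have "(c *\<^sub>C a i, c *\<^sub>C b i) \<in> G" using RG unfolding R_def by blast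
      then have "c *\<^sub>C a i \<in> fst ` G" by (rule image_eqI[rotated]) simp
      then have "inner w (c *\<^sub>C a i) = 0" by (rule w)
      then have "Re (cnj c * c) = 0" by (simp add: inner_eq_Re_cinner cinner_scaleC_right c_def)
      then show ?thesis by (simp add: c_def[symmetric] complex_eq_iff)
    qed
    then show False using total \<open>w \<noteq> 0\<close> by blast
  qed
  have "\<exists>y. (x, y) \<in> G" for x
    using full[of x] by (metis imageE prod.collapse)
  then obtain V where V: "\<And>x. (x, V x) \<in> G" by metis
  show thesis
  proof (rule that)
    show "cinner (V x) (V y) = cinner x y" for x y
      using pres[OF V V] by simp
    fix i
    have "(1 *\<^sub>C a i, 1 *\<^sub>C b i) \<in> G" using RG unfolding R_def by blast
    then have "(a i, b i) \<in> G" unfolding one .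
    then have "(a i, V (a i)) - (a i, b i) \<in> G"
      using V subG by (intro subspace_diff)
    from norm_eq[OF this] show "V (a i) = b i" by simp
  qed
qed


section \<open>Convolution of noncommutative power series\<close>

lemma splits_Nil: "splits [] = {([], [])}"
  by (auto simp: splits_def)

lemma splits_Cons: "splits (i # \<gamma>) = insert ([], i # \<gamma>) ((\<lambda>(\<alpha>, \<beta>). (i # \<alpha>, \<beta>)) ` splits \<gamma>)"
  (is "_ = ?R")
proof (rule set_eqI)
  show "p \<in> splits (i # \<gamma>) \<longleftrightarrow> p \<in> ?R" for p
    by (cases p; cases "fst p") (auto simp: splits_def image_def)
qed

lemma splits_snoc: "splits (\<gamma> @ [i]) = insert (\<gamma> @ [i], []) ((\<lambda>(\<alpha>, \<beta>). (\<alpha>, \<beta> @ [i])) ` splits \<gamma>)"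
  (is "_ = ?R")
proof (rule set_eqI)
  show "p \<in> splits (\<gamma> @ [i]) \<longleftrightarrow> p \<in> ?R" for p
    by (cases p; cases "snd p" rule: rev_cases) (auto simp: splits_def image_def simp flip: append_assoc)
qed

lemma finite_splits [simp]: "finite (splits \<gamma>)"
  by (induction \<gamma>) (auto simp: splits_Nil splits_Cons)

lemma sum_splits_Cons:
  "(\<Sum>(\<alpha>, \<beta>)\<in>splits (i # \<gamma>). f \<alpha> \<beta>) = f [] (i # \<gamma>) + (\<Sum>(\<alpha>, \<beta>)\<in>splits \<gamma>. f (i # \<alpha>) \<beta>)"
proof -
  have "inj_on (\<lambda>(\<alpha>, \<beta>). (i # \<alpha>, \<beta>)) (splits \<gamma>)" by (auto simp: inj_on_def)
  then have "(\<Sum>(\<alpha>, \<beta>)\<in>(\<lambda>(\<alpha>, \<beta>). (i # \<alpha>, \<beta>)) ` splits \<gamma>. f \<alpha> \<beta>)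
      = (\<Sum>(\<alpha>, \<beta>)\<in>splits \<gamma>. f (i # \<alpha>) \<beta>)"
    by (subst sum.reindex) (auto intro!: sum.cong)
  then show ?thesis
    unfolding splits_Cons by (subst sum.insert) auto
qed

lemma sum_splits_snoc:
  "(\<Sum>(\<alpha>, \<beta>)\<in>splits (\<gamma> @ [i]). f \<alpha> \<beta>) = f (\<gamma> @ [i]) [] + (\<Sum>(\<alpha>, \<beta>)\<in>splits \<gamma>. f \<alpha> (\<beta> @ [i]))"
proof -
  have "inj_on (\<lambda>(\<alpha>, \<beta>). (\<alpha>, \<beta> @ [i])) (splits \<gamma>)" by (auto simp: inj_on_def)
  then have "(\<Sum>(\<alpha>, \<beta>)\<in>(\<lambda>(\<alpha>, \<beta>). (\<alpha>, \<beta> @ [i])) ` splits \<gamma>. f \<alpha> \<beta>)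
      = (\<Sum>(\<alpha>, \<beta>)\<in>splits \<gamma>. f \<alpha> (\<beta> @ [i]))"
    by (subst sum.reindex) (auto intro!: sum.cong)
  then show ?thesis
    unfolding splits_snoc by (subst sum.insert) auto
qed

lemma sum_splits_right_Nil:
  assumes "\<And>\<alpha> \<beta>. \<beta> \<noteq> [] \<Longrightarrow> f \<alpha> \<beta> = 0"
  shows "(\<Sum>(\<alpha>, \<beta>)\<in>splits \<gamma>. f \<alpha> \<beta>) = f \<gamma> []"
proof (cases \<gamma> rule: rev_cases)
  case (snoc \<gamma>' i)
  then show ?thesis by (auto simp: sum_splits_snoc assms intro!: sum.neutral)
qed (simp add: splits_Nil)

lemma sum_splits_left_Nil:
  assumes "\<And>\<alpha> \<beta>. \<alpha> \<noteq> [] \<Longrightarrow> f \<alpha> \<beta> = 0"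
  shows "(\<Sum>(\<alpha>, \<beta>)\<in>splits \<gamma>. f \<alpha> \<beta>) = f [] \<gamma>"
proof (cases \<gamma>)
  case (Cons i \<gamma>')
  then show ?thesis by (auto simp: sum_splits_Cons assms intro!: sum.neutral)
qed (simp add: splits_Nil)

lemma transfer_series_Nil:
  assumes "C 0 = 0"
  shows "transfer_series A B C D [] = D"
  by (rule ext)
    (simp add: transfer_series_def series_const_def series_mult_def resolvent_series_def
      Z_series_def splits_Nil assms)

text \<open>The row \<open>Z\<close> has only coefficients at single letters, so it must absorb the last letter of the word.\<close>

lemma transfer_series_snoc:
  assumes C: "\<And>\<alpha>. C (op_word A \<alpha> 0) = 0"
  shows "transfer_series A B C D (v @ [j]) u = C (op_word A v (B u $ j))"
proof -
  have 1: "(series_const C \<star> resolvent_series A) \<alpha> = C \<circ> op_word A \<alpha>" for \<alpha>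
    by (rule ext) (simp add: series_mult_def series_const_def resolvent_series_def
        sum_splits_left_Nil[of "\<lambda>\<alpha> \<beta>. (if \<alpha> = [] then C else (\<lambda>_. 0)) (op_word A \<beta> _)"])
  have 2: "(series_const C \<star> resolvent_series A \<star> Z_series) (v @ [j]) x = C (op_word A v (x $ j))"
    for x
    unfolding series_mult_def[of "series_const C \<star> resolvent_series A"] 1 comp_apply sum_splits_snoc
    by (subst sum_splits_right_Nil) (auto simp: Z_series_def C split: list.split)
  have 3: "(series_const C \<star> resolvent_series A \<star> Z_series) \<alpha> 0 = 0" for \<alpha>
    unfolding series_mult_def[of "series_const C \<star> resolvent_series A"] 1 comp_apply
    by (intro sum.neutral) (auto simp: Z_series_def C split: list.split)
  have "(series_const C \<star> resolvent_series A \<star> Z_series \<star> series_const B) (v @ [j]) u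
      = C (op_word A v (B u $ j))"
    unfolding series_mult_def[of "series_const C \<star> resolvent_series A \<star> Z_series"]
    by (subst sum_splits_right_Nil) (simp_all add: series_const_def 2 3)
  then show ?thesis by (simp add: transfer_series_def series_const_def)
qed

text \<open>The Szego kernel matches a suffix \<open>\<alpha>2\<close> of \<open>\<alpha>\<close> with the prefix \<open>rev \<alpha>2\<close> of \<open>\<beta>\<close>, that is, with the
  same suffix of \<open>rev \<beta>\<close>.\<close>

lemma schur_product_coefficient:
  assumes S0: "\<And>\<alpha>. S \<alpha> 0 = 0"
  shows "(in_z S \<star>\<star> szego_kernel \<star>\<star> in_w (series_adj S)) \<alpha> \<beta> y =
    (\<Sum>(\<beta>1, \<beta>2)\<in>splits \<beta>. \<Sum>(\<alpha>1, \<alpha>2)\<in>splits \<alpha>.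
       if \<beta>1 = rev \<alpha>2 then S \<alpha>1 (cadjoint (S (rev \<beta>2)) y) else 0)"
proof -
  have 1: "(in_z S \<star>\<star> szego_kernel) \<alpha> \<beta> x
      = (\<Sum>(\<alpha>1, \<alpha>2)\<in>splits \<alpha>. if \<beta> = rev \<alpha>2 then S \<alpha>1 x else 0)" for \<alpha> \<beta> x
    unfolding biseries_mult_def
    by (intro sum.cong refl, clarify, subst sum_splits_left_Nil)
      (auto simp: in_z_def szego_kernel_def S0)
  show ?thesis
    unfolding biseries_mult_def[of "in_z S \<star>\<star> szego_kernel"]
    by (rule sum_splits_right_Nil[THEN trans])
      (auto simp: in_w_def 1 S0 series_adj_def intro!: sum.neutral)
qed

text \<open>A nonempty common suffix of \<open>\<alpha>\<close> and \<open>\<beta>\<close> contains their last letters, which must then agree. So the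
  terms of the convolution with nonempty suffix form the same convolution for the shortened words,
  and the only other term is \<open>S\<^sub>\<alpha> S\<^sub>\<beta>\<^sup>*\<close>.\<close>

lemma schur_kernel_recursion:
  assumes S: "\<And>\<alpha>. S \<alpha> 0 = 0"
  shows "schur_kernel S \<alpha> (rev \<beta>) y + S \<alpha> (cadjoint (S \<beta>) y) =
    (if \<alpha> = [] \<and> \<beta> = [] then y
     else if \<alpha> = [] \<or> \<beta> = [] \<or> last \<alpha> \<noteq> last \<beta> then 0
     else schur_kernel S (butlast \<alpha>) (rev (butlast \<beta>)) y)"
proof -
  let ?Q = "\<lambda>\<alpha> \<beta>. (in_z S \<star>\<star> szego_kernel \<star>\<star> in_w (series_adj S)) \<alpha> (rev \<beta>) y"
  note Q = schur_product_coefficient[of S, OF S]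
  have Q_left: "?Q [] \<beta> = S [] (cadjoint (S \<beta>) y)" for \<beta>
    unfolding Q splits_Nil by (simp add: sum_splits_left_Nil)
  have Q_right: "?Q \<alpha> [] = S \<alpha> (cadjoint (S []) y)" for \<alpha>
    unfolding Q rev.simps splits_Nil by (simp add: sum_splits_right_Nil)
  have Q_snoc: "?Q (\<alpha> @ [i]) (\<beta> @ [j]) =
      S (\<alpha> @ [i]) (cadjoint (S (\<beta> @ [j])) y) + (if i = j then ?Q \<alpha> \<beta> else 0)" for \<alpha> \<beta> i j
  proof -
    have head: "(\<Sum>(\<alpha>1, \<alpha>2)\<in>splits (\<alpha> @ [i]). if [] = rev \<alpha>2 then S \<alpha>1 x else 0) = S (\<alpha> @ [i]) x"
      for x by (rule sum_splits_right_Nil[THEN trans]) auto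
    have tail: "(\<Sum>(\<alpha>1, \<alpha>2)\<in>splits (\<alpha> @ [i]). if j # \<gamma> = rev \<alpha>2 then S \<alpha>1 x else 0)
        = (if i = j then \<Sum>(\<alpha>1, \<alpha>2)\<in>splits \<alpha>. if \<gamma> = rev \<alpha>2 then S \<alpha>1 x else 0 else 0)" for \<gamma> x
      unfolding sum_splits_snoc by (auto intro!: sum.neutral)
    show ?thesis
      unfolding Q rev_append rev.simps append.simps sum_splits_Cons head tail
      by simp
  qed
  show ?thesis
  proof (cases \<alpha> rule: rev_cases)
    case Nil
    then show ?thesis by (simp add: schur_kernel_def Q_left szego_kernel_def)
  next
    case \<alpha>: (snoc \<alpha>' i)
    show ?thesis
    proof (cases \<beta> rule: rev_cases)
      case Nil
      then show ?thesis using Q_right[of \<alpha>] by (simp add: \<alpha> schur_kernel_def szego_kernel_def)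
    next
      case (snoc \<beta>' j)
      then show ?thesis
        using Q_snoc[of \<alpha>' i \<beta>' j] by (auto simp: \<alpha> schur_kernel_def szego_kernel_def)
    qed
  qed
qed


section \<open>Colligations from the kernel identity\<close>

lemma cinner_axis_right: "cinner \<xi> (axis j x) = cinner (\<xi> $ j) x"
proof -
  have "cinner \<xi> (axis j x) = (\<Sum>i\<in>UNIV. if i = j then cinner (\<xi> $ i) x else 0)"
    unfolding cinner_vec_def by (intro sum.cong) (auto simp: axis_def cinner.zero_right)
  then show ?thesis by simp
qed

lemma cinner_axis_axis: "cinner (axis i x) (axis j y) = (if i = j then cinner x y else 0)"
  unfolding cinner_axis_right by (simp add: axis_def cinner.zero_left)

definition observability_adjoint ::
    "('x::chilbert_space \<Rightarrow> 'y::complex_inner) \<Rightarrow> ('d \<Rightarrow> 'x \<Rightarrow> 'x) \<Rightarrow> 'd list \<Rightarrow> 'y \<Rightarrow> 'x"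
  where "observability_adjoint C A v = cadjoint (C \<circ> op_word A v)"

text \<open>The vectors \<open>y\<close> and \<open>e\<^sub>j \<otimes> O\<^sub>w\<^sup>* y\<close> are indexed uniformly by words, as those belonging to \<open>\<emptyset>\<close> and to
  \<open>wj\<close>, to match the recursion of the kernel under deletion of the last letter.\<close>

definition shifted_kernel_vector ::
    "('x::chilbert_space \<Rightarrow> 'y::complex_inner) \<Rightarrow> ('d::finite \<Rightarrow> 'x \<Rightarrow> 'x) \<Rightarrow> 'd list \<times> 'y
      \<Rightarrow> ('x ^ 'd) \<times> 'y"
  where "shifted_kernel_vector C A = (\<lambda>(v, y).
    if v = [] then (0, y)
    else (axis (last v) (observability_adjoint C A (butlast v) y), 0))"

context
  fixes C :: "'x::chilbert_space \<Rightarrow> 'y::chilbert_space" and A :: "'d::finite \<Rightarrow> 'x \<Rightarrow> 'x"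
  assumes pair: "output_pair C A"
begin

lemma bounded_clinear_output_word: "bounded_clinear (C \<circ> op_word A v)"
  using pair by (auto simp: output_pair_def intro: bounded_clinear_compose bounded_clinear_op_word)

lemma output_word_0: "C (op_word A v 0) = 0"
  using bounded_clinearD(4)[OF bounded_clinear_output_word, of v] by simp

lemma cinner_observability_adjoint:
  "cinner x (observability_adjoint C A v y) = cinner (C (op_word A v x)) y"
  using cinner_cadjoint[OF bounded_clinear_output_word[of v], of x y]
  by (simp add: observability_adjoint_def)

lemma pair_kernel_eq_gram:
  "cinner (pair_kernel C A \<alpha> (rev \<beta>) y) y'
    = cinner (observability_adjoint C A \<beta> y) (observability_adjoint C A \<alpha> y')"
proof -
  have "cadjoint (C \<circ> op_word A \<beta>) = cadjoint (op_word A \<beta>) \<circ> cadjoint C"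
    using pair by (intro cadjoint_compose bounded_clinear_op_word) (auto simp: output_pair_def)
  then show ?thesis
    unfolding cinner_observability_adjoint
    by (simp add: pair_kernel_def observability_adjoint_def)
qed

text \<open>A vector \<open>\<xi>\<^sub>j\<close> orthogonal to the ranges of all \<open>O\<^sub>w\<^sup>*\<close> is annihilated by every \<open>O\<^sub>w\<close>, hence is zero by
  observability.\<close>

lemma shifted_kernel_vectors_total:
  assumes "observable_pair C A"
    and ortho: "\<And>p. cinner q (shifted_kernel_vector C A p) = 0"
  shows "q = 0"
proof -
  obtain \<xi> \<eta> where q: "q = (\<xi>, \<eta>)" by fastforce
  have "cinner \<eta> \<eta> = 0"
    using ortho[of "([], \<eta>)"]
    by (simp add: q shifted_kernel_vector_def cinner_prod_def cinner.zero_right)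
  then have "\<eta> = 0" by (simp add: cinner_self)
  have "\<xi> $ j = 0" for j
  proof -
    have "C (op_word A v (\<xi> $ j)) = 0" for v
    proof -
      have "cinner (C (op_word A v (\<xi> $ j))) y = 0" for y
        using ortho[of "(v @ [j], y)"]
        by (simp add: q shifted_kernel_vector_def cinner_prod_def cinner.zero_right
            cinner_axis_right cinner_observability_adjoint)
      from this[of "C (op_word A v (\<xi> $ j))"] show ?thesis by (simp add: cinner_self)
    qed
    then have "observability_op C A (\<xi> $ j) = observability_op C A 0"
      by (simp add: observability_op_def output_word_0)
    with \<open>observable_pair C A\<close> show ?thesis
      by (simp add: observable_pair_def inj_def)
  qed
  with \<open>\<eta> = 0\<close> show ?thesis by (simp add: q vec_eq_iff prod_eq_iff)
qed

text \<open>The left-hand side is the term \<open>O\<^bsub>v'\<^esub> O\<^sub>v\<^sup>* + S\<^bsub>v'\<^esub> S\<^sub>v\<^sup>*\<close> paired with \<open>y\<close> and \<open>y'\<close>, which the kernel identity turns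
  into the left-hand side of the kernel recursion.\<close>

lemma gram_equality:
  fixes S :: "('d, 'u::chilbert_space, 'y) op_series"
  assumes S: "\<And>\<alpha>. bounded_clinear (S \<alpha>)" and K: "schur_kernel S = pair_kernel C A"
  shows "cinner (observability_adjoint C A v y, cadjoint (S v) y)
      (observability_adjoint C A v' y', cadjoint (S v') y')
    = cinner (shifted_kernel_vector C A (v, y)) (shifted_kernel_vector C A (v', y'))"
proof -
  have S0: "S \<alpha> 0 = 0" for \<alpha> by (rule bounded_clinearD(4)[OF S])
  have "cinner (observability_adjoint C A v y, cadjoint (S v) y)
      (observability_adjoint C A v' y', cadjoint (S v') y')
      = cinner (pair_kernel C A v' (rev v) y + S v' (cadjoint (S v) y)) y'"
    by (simp add: cinner_prod_def pair_kernel_eq_gram cinner.add_left cinner_cadjoint[OF S])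
  also have "\<dots> = cinner (if v' = [] \<and> v = [] then y
      else if v' = [] \<or> v = [] \<or> last v' \<noteq> last v then 0
      else pair_kernel C A (butlast v') (rev (butlast v)) y) y'"
    using schur_kernel_recursion[of S v' v y, OF S0] by (simp only: K)
  also have "\<dots> = cinner (shifted_kernel_vector C A (v, y)) (shifted_kernel_vector C A (v', y'))"
    by (auto simp: shifted_kernel_vector_def cinner_prod_def cinner.zero_left cinner.zero_right
        cinner_axis_axis pair_kernel_eq_gram)
  finally show ?thesis .
qed

text \<open>The coefficients \<open>C A\<^sup>v B\<^sub>j u\<close> of the transfer series are the values of the observability operator
  at \<open>B\<^sub>j u\<close>.\<close>

lemma realization_unique:
  assumes "observable_pair C A"
    and "transfer_series A B C D = transfer_series A B' C D'"
  shows "B = B'"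
proof -
  have "B u $ j = B' u $ j" for u j
  proof -
    have "C (op_word A v (B u $ j)) = C (op_word A v (B' u $ j))" for v
      using transfer_series_snoc[of C A, OF output_word_0] assms(2) by metis
    then have "observability_op C A (B u $ j) = observability_op C A (B' u $ j)"
      by (simp add: observability_op_def)
    with assms(1) show ?thesis by (simp add: observable_pair_def inj_eq)
  qed
  then show ?thesis by (simp add: fun_eq_iff vec_eq_iff)
qed

text \<open>The operator \<open>W\<close> below is the adjoint of the isometry supplied by the Gram matrices. Each of its
  entries is read off by pairing with the total family.\<close>

lemma realization_exists:
  fixes S :: "('d, 'u::chilbert_space, 'y) op_series"
  assumes S: "\<And>\<alpha>. bounded_clinear (S \<alpha>)"
    and obs: "observable_pair C A" and K: "schur_kernel S = pair_kernel C A"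
  obtains B where "bounded_clinear B" "coisometry (colligation A B C (S []))"
    "S = transfer_series A B C (S [])"
proof -
  define g where "g = shifted_kernel_vector C A"
  have total: "q = 0" if "\<And>p. cinner q (g p) = 0" for q
    using shifted_kernel_vectors_total[OF obs] that by (simp add: g_def)
  obtain V :: "('x ^ 'd) \<times> 'y \<Rightarrow> 'x \<times> 'u" where V: "\<And>p q. cinner (V p) (V q) = cinner p q"
    and Vg: "\<And>p. V (g p) = (observability_adjoint C A (fst p) (snd p), cadjoint (S (fst p)) (snd p))"
    using isometry_from_gram_equality[of
        "\<lambda>p. (observability_adjoint C A (fst p) (snd p), cadjoint (S (fst p)) (snd p))" g]
      gram_equality[OF S K] total by (auto simp: g_def)
  have Vlin: "bounded_clinear V" by (rule bounded_clinear_if_preserves_cinner[OF V])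
  define W where "W = cadjoint V"
  have Wlin: "bounded_clinear W" unfolding W_def by (rule bounded_clinear_cadjoint[OF Vlin])
  have WV: "cinner (W p) q = cinner p (V q)" for p q
    unfolding W_def by (simp add: cinner_cadjoint'[OF Vlin])
  define B where "B u = fst (W (0, u))" for u
  have g_Nil: "g ([], y) = (0, y)" for y by (simp add: g_def shifted_kernel_vector_def)
  have g_snoc: "g (v @ [j], y) = (axis j (observability_adjoint C A v y), 0)" for v j y
    by (simp add: g_def shifted_kernel_vector_def)
  have W_state: "W (x, 0) = (\<chi> j. A j x, C x)" for x
  proof -
    have "cinner (W (x, 0) - (\<chi> j. A j x, C x)) (g p) = 0" for p
    proof -
      obtain v y where p: "p = (v, y)" by fastforce
      have "cinner (W (x, 0)) (g p) = cinner (C (op_word A v x)) y"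
        unfolding WV Vg by (simp add: p cinner_prod_def cinner.zero_left cinner_observability_adjoint)
      moreover have "cinner (\<chi> j. A j x, C x) (g p) = cinner (C (op_word A v x)) y"
        by (cases v rule: rev_cases)
          (simp_all add: p g_Nil g_snoc cinner_prod_def cinner.zero_right cinner_axis_right
            cinner_observability_adjoint op_word_append)
      ultimately show ?thesis by (simp add: cinner.diff_left)
    qed
    then have "W (x, 0) - (\<chi> j. A j x, C x) = 0" by (rule total)
    then show ?thesis by simp
  qed
  have W_input: "cinner (W (0, u)) (g (v, y)) = cinner (S v u) y" for u v y
    unfolding WV Vg by (simp add: cinner_prod_def cinner.zero_left cinner_cadjoint[OF S])
  have W_colligation: "W = colligation A B C (S [])"
  proof
    fix p :: "'x \<times> 'u"
    obtain x u where p: "p = (x, u)" by fastforce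
    have "cinner (snd (W (0, u))) y = cinner (S [] u) y" for y
      using W_input[of u "[]" y] by (simp add: g_Nil cinner_prod_def cinner.zero_right)
    then have "snd (W (0, u)) = S [] u" by (rule cinner_left_ext)
    then have "W (0, u) = (B u, S [] u)" by (simp add: B_def prod_eq_iff)
    moreover have "W (x, u) = W (x, 0) + W (0, u)"
      using bounded_clinearD(3)[OF Wlin, of "(x, 0)" "(0, u)"] by simp
    ultimately show "W p = colligation A B C (S []) p"
      by (simp add: p colligation_def W_state)
  qed
  obtain k where k: "\<And>p. norm (W p) \<le> norm p * k"
    using bounded_linear.bounded[OF bounded_clinearD(1)[OF Wlin]] by blast
  show thesis
  proof (rule that)
    show "bounded_clinear B"
    proof (rule bounded_clinearI)
      show "norm (B u) \<le> norm u * k" for u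
        using norm_fst_le[of "fst (W (0, u))" "snd (W (0, u))"] k[of "(0, u)"] by (simp add: B_def norm_Pair)
      show "B (u + u') = B u + B u'" for u u'
        using bounded_clinearD(3)[OF Wlin, of "(0, u)" "(0, u')"] by (simp add: B_def)
      show "B (c *\<^sub>C u) = c *\<^sub>C B u" for c u
        using bounded_clinearD(2)[OF Wlin, of c "(0, u)"]
        by (simp add: B_def scaleC_prod_def scaleC_zero_right)
    qed
    have "cadjoint W = V" by (rule cadjoint_unique) (rule WV)
    moreover have "W (V q) = q" for q
      by (rule cinner_left_ext) (simp add: WV V)
    ultimately show "coisometry (colligation A B C (S []))"
      using Wlin by (auto simp: coisometry_def W_colligation[symmetric])
    show "S = transfer_series A B C (S [])"
    proof
      fix \<alpha>
      show "S \<alpha> = transfer_series A B C (S []) \<alpha>"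
      proof (cases \<alpha> rule: rev_cases)
        case Nil
        then show ?thesis
          using output_word_0[of "[]"] by (simp add: transfer_series_Nil)
      next
        case (snoc v j)
        have "cinner (S (v @ [j]) u) y = cinner (C (op_word A v (B u $ j))) y" for u y
          using W_input[of u "v @ [j]" y]
          by (simp add: B_def g_snoc cinner_prod_def cinner.zero_right cinner_axis_right
              cinner_observability_adjoint)
        then have "S (v @ [j]) u = C (op_word A v (B u $ j))" for u
          by (rule cinner_left_ext)
        then show ?thesis
          by (simp add: snoc fun_eq_iff transfer_series_snoc[of C A, OF output_word_0])
      qed
    qed
  qed
qed

end

theorem theorem3p8:
  fixes S :: "'d::finite list \<Rightarrow> 'u::chilbert_space \<Rightarrow> 'y::chilbert_space"
    and A :: "'d \<Rightarrow> 'x::chilbert_space \<Rightarrow> 'x"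
    and C :: "'x \<Rightarrow> 'y"
  assumes "S \<in> nc_schur_class"
    and "output_pair C A"
    and "observable_pair C A"
    and "contractive_pair C A"
    and "schur_kernel S = pair_kernel C A"
  shows "\<exists>!B :: 'u \<Rightarrow> 'x ^ 'd.
           bounded_clinear B \<and>
           coisometry (colligation A B C (S [])) \<and>
           S = transfer_series A B C (S [])"
proof -
  have "\<And>\<alpha>. bounded_clinear (S \<alpha>)"
    using assms(1) by (simp add: nc_schur_class_def)
  then obtain B where "bounded_clinear B" "coisometry (colligation A B C (S []))"
    "S = transfer_series A B C (S [])"
    using realization_exists assms by metis
  moreover have "B' = B''" if "S = transfer_series A B' C (S [])"
    "S = transfer_series A B'' C (S [])" for B' B''
    using realization_unique[OF assms(2,3)] trans[OF sym[OF that(1)] that(2)] by blast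
  ultimately show ?thesis by blast
qed

end
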